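(* Let $0<\alpha<n$, let $A$ be a real $n\times n$ matrix with $A^N=I$ for some $N\in\mathbb{N}$ (so $A$ is invertible), and define $$T_Af(x)=\int_{\mathbb{R}^n}\frac{1}{|x-Ay|^{n-\alpha}}\,f(y)\,dy .$$ Let $p:\mathbb{R}^n\to[1,\infty)$ be continuous with $p_+<\frac n\alpha$, and let $q(\cdot)$ be defined by $\frac1{q(\cdot)}=\frac1{p(\cdot)}-\frac{\alpha}{n}$. If $T_A$ is bounded from $L^{p(\cdot)}(\mathbb{R}^n)$ into $L^{q(\cdot)}(\mathbb{R}^n)$, then $p(Ay)=p(y)$ for all $y\in\mathbb{R}^n$.
   Context: $\mathbb{N}$ denotes the positive integers and $I$ the identity matrix. For a measurable function $p:\mathbb{R}^n\to[1,\infty)$, $p_+=\operatorname{ess\,sup}p$. The variable exponent space $L^{p(\cdot)}(\mathbb{R}^n)$ is the Banach space of measurable functions $f$ on $\mathbb{R}^n$ such that $\int (|f(x)|/\lambda)^{p(x)}dx<\infty$ for some $\lambda>0$, with norm $\|f\|_{p(\cdot)}=\inf\{\lambda>0:\int (|f(x)|/\lambda)^{p(x)}dx\le1\}$; $L^{q(\cdot)}(\mathbb{R}^n)$ is defined in the same way. $T_A$ is bounded from $L^{p(\cdot)}$ into $L^{q(\cdot)}$ if there is a constant $C$ with $\|T_Af\|_{q(\cdot)}\le C\|f\|_{p(\cdot)}$ for all $f\in L^{p(\cdot)}(\mathbb{R}^n)$. *)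

theory Defs
  imports "HOL-Analysis.Analysis" "HOL-Probability.Essential_Supremum"
begin

definition vexp_modular :: "('a::euclidean_space \<Rightarrow> real) \<Rightarrow> ('a \<Rightarrow> real) \<Rightarrow> ennreal" where
  "vexp_modular p f = (\<integral>\<^sup>+ x. ennreal (\<bar>f x\<bar> powr p x) \<partial>lebesgue)"

(* Elements are functions, not classes modulo almost-everywhere equality;
   the norm below does not see the difference. *)
definition vexp_space :: "('a::euclidean_space \<Rightarrow> real) \<Rightarrow> ('a \<Rightarrow> real) set" where
  "vexp_space p = {f \<in> borel_measurable lebesgue.
     \<exists>l>0. vexp_modular p (\<lambda>x. f x / l) < \<infinity>}"

(* Meaningful only on vexp_space p: elsewhere the set may be empty, and the
   real infimum of the empty set is a junk value. *)
definition vexp_norm :: "('a::euclidean_space \<Rightarrow> real) \<Rightarrow> ('a \<Rightarrow> real) \<Rightarrow> real" where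
  "vexp_norm p f = Inf {l. 0 < l \<and> vexp_modular p (\<lambda>x. f x / l) \<le> 1}"

definition vexp_bounded ::
  "('a::euclidean_space \<Rightarrow> real) \<Rightarrow> ('a \<Rightarrow> real) \<Rightarrow> (('a \<Rightarrow> real) \<Rightarrow> 'a \<Rightarrow> real) \<Rightarrow> bool" where
  "vexp_bounded p q T \<longleftrightarrow>
     (\<exists>C. \<forall>f\<in>vexp_space p. T f \<in> vexp_space q \<and> vexp_norm q (T f) \<le> C * vexp_norm p f)"

definition ess_sup_exponent :: "('a::euclidean_space \<Rightarrow> real) \<Rightarrow> ereal" where
  "ess_sup_exponent p = esssup lebesgue (\<lambda>x. ereal (p x))"

(* The type real^'n^'n carries no matrix monoid structure, so the
   class-based power operator is not the matrix power. *)
definition matrix_power :: "real^'n^'n \<Rightarrow> nat \<Rightarrow> real^'n^'n" where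
  "matrix_power A k = (((**) A) ^^ k) (mat 1)"

(* The kernel takes the value 0 instead of infinity at x = A y, which for
   invertible A concerns a single y.  At points x where the integrand is not
   integrable the Bochner integral is 0; for f in vexp_space p with
   1 \<le> p and ess_sup_exponent p < n / \<alpha>, these x form a null set. *)
definition T_op :: "real \<Rightarrow> real^'n^'n \<Rightarrow> (real^'n \<Rightarrow> real) \<Rightarrow> real^'n \<Rightarrow> real" where
  "T_op \<alpha> A f x =
     (\<integral> y. 1 / norm (x - A *v y) powr (real CARD('n) - \<alpha>) * f y \<partial>lebesgue)"

end

theory Submission
  imports Defs
begin

text \<open>
  Apply \<open>T\<^sub>A\<close> to the indicator of a small ball of radius \<open>r\<close> around \<open>y\<close>. On a ball of radius \<open>r\<close>
  whose centre is at distance comparable to \<open>r\<close> from \<open>A y\<close>, but which stays away from the image of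
  the first ball so that the kernel is bounded, the result is at least a constant times \<open>r\<^sup>\<alpha>\<close>.
  If \<open>p (A y) > a > b > p y\<close>, comparing norms gives \<open>r\<^sup>n\<^sup>/\<^sup>a \<le> C r\<^sup>n\<^sup>/\<^sup>b\<close> for all small \<open>r\<close>, which
  is impossible. Hence \<open>p (A y) \<le> p y\<close>, and equality follows since \<open>A\<close> has finite order.
\<close>

section \<open>Norm bounds for variable exponents\<close>

text \<open>Since the measure \<open>m\<close> of \<open>S\<close> is at most 1, so is
  \<open>l = m powr (1 / b)\<close>. Powers of \<open>1 / l\<close> therefore increase with the
  exponent, and the integrand on \<open>S\<close> is at most \<open>(1 / l) powr b = 1 / m\<close>,
  which integrates to 1.\<close>

lemma vexp_modular_indicator_le:
  assumes S: "S \<in> lmeasurable" "0 < measure lebesgue S" "measure lebesgue S \<le> 1"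
    and b: "0 < b" "\<And>x. x \<in> S \<Longrightarrow> p x \<le> b"
  shows "vexp_modular p (\<lambda>x. indicator S x / measure lebesgue S powr (1 / b)) \<le> 1"
proof -
  define m where "m = measure lebesgue S"
  define l where "l = m powr (1 / b)"
  have m: "0 < m" "m \<le> 1" using S by (auto simp: m_def)
  have l: "0 < l" "l \<le> 1" using m b by (auto simp: l_def powr_le1)
  have lb: "(1 / l) powr b = 1 / m"
    using m b by (simp add: l_def powr_divide powr_powr)
  have "ennreal (\<bar>indicator S x / l\<bar> powr p x) \<le> ennreal (1 / m) * indicator S x" for x
  proof (cases "x \<in> S")
    case True
    have "(1 / l) powr p x \<le> (1 / l) powr b"
      using l b(2)[OF True] by (intro powr_mono) auto
    then show ?thesis using True l lb by (auto intro!: ennreal_leI)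
  qed auto
  then have "vexp_modular p (\<lambda>x. indicator S x / l) \<le> (\<integral>\<^sup>+ x. ennreal (1 / m) * indicator S x \<partial>lebesgue)"
    unfolding vexp_modular_def by (intro nn_integral_mono) auto
  also have "\<dots> = ennreal (1 / m) * emeasure lebesgue S"
    using S by (intro nn_integral_cmult_indicator) (auto simp: fmeasurableD)
  also have "\<dots> = ennreal (1 / m) * ennreal m"
    using S by (simp add: m_def emeasure_eq_measure2)
  also have "\<dots> = 1"
    using m by (simp flip: ennreal_mult)
  finally show ?thesis by (simp add: l_def m_def)
qed

text \<open>The preceding bound makes \<open>m powr (1 / b)\<close> an admissible level in the
  infimum that defines the norm. The sign of the norm is recorded because the constant in
  \<open>vexp_bounded\<close> may be negative.\<close>

lemma indicator_in_vexp_space: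
  assumes S: "S \<in> lmeasurable" "0 < measure lebesgue S" "measure lebesgue S \<le> 1"
    and b: "0 < b" "\<And>x. x \<in> S \<Longrightarrow> p x \<le> b"
  shows "indicator S \<in> vexp_space p"
    and "vexp_norm p (indicator S) \<le> measure lebesgue S powr (1 / b)"
    and "0 \<le> vexp_norm p (indicator S)"
proof -
  define l where "l = measure lebesgue S powr (1 / b)"
  have l: "0 < l" using S by (auto simp: l_def)
  have mod: "vexp_modular p (\<lambda>x. indicator S x / l) \<le> 1"
    unfolding l_def by (rule vexp_modular_indicator_le) (use assms in auto)
  have "vexp_modular p (\<lambda>x. indicator S x / l) < \<infinity>"
    by (rule le_less_trans[OF mod]) simp
  then show "indicator S \<in> vexp_space p"
    using S l by (auto simp: vexp_space_def fmeasurableD)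
  show "vexp_norm p (indicator S) \<le> measure lebesgue S powr (1 / b)"
    unfolding vexp_norm_def l_def[symmetric]
    using l mod by (intro cInf_lower bdd_belowI[of _ 0]) auto
  show "0 \<le> vexp_norm p (indicator S)"
    unfolding vexp_norm_def
    using l mod by (intro cInf_greatest) auto
qed

text \<open>Membership only provides a level with finite modular. As \<open>q\<close> is at least 1,
  enlarging the level by a factor \<open>t \<ge> 1\<close> divides the modular by at least
  \<open>t\<close>, so a large factor brings it below 1. Thus the infimum in
  \<open>vexp_norm\<close> is over a nonempty set.\<close>

lemma vexp_space_modular_le_1:
  assumes q: "\<And>x. 1 \<le> q x" and q_meas[measurable]: "q \<in> borel_measurable lebesgue"
    and f: "f \<in> vexp_space q"
  obtains l where "0 < l" "vexp_modular q (\<lambda>x. f x / l) \<le> 1"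
proof -
  obtain k where k: "k > 0" and fin: "vexp_modular q (\<lambda>x. f x / k) < \<infinity>"
    and [measurable]: "f \<in> borel_measurable lebesgue"
    using f by (auto simp: vexp_space_def)
  define M where "M = enn2real (vexp_modular q (\<lambda>x. f x / k))"
  have M: "vexp_modular q (\<lambda>x. f x / k) = ennreal M" "0 \<le> M"
    using fin by (auto simp: M_def)
  \<comment> \<open>The bound \<open>1 \<le> t\<close> gives \<open>t \<le> t powr q x\<close>; the
    bound \<open>M \<le> t\<close> makes the rescaled modular at most
    \<open>M / t \<le> 1\<close>.\<close>
  define t where "t = max 1 M"
  have t: "1 \<le> t" "M \<le> t" by (auto simp: t_def)
  have pt: "\<bar>f x / k\<bar> powr q x \<ge> t * \<bar>f x / (k * t)\<bar> powr q x" for x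
  proof -
    have "t powr 1 \<le> t powr q x" using t q by (intro powr_mono) auto
    then have "t * \<bar>f x / (k * t)\<bar> powr q x \<le> t powr q x * \<bar>f x / (k * t)\<bar> powr q x"
      using t by (intro mult_right_mono) auto
    also have "\<dots> = \<bar>f x / k\<bar> powr q x"
      using t k by (subst powr_mult[symmetric]) (auto simp: abs_mult)
    finally show ?thesis .
  qed
  have "vexp_modular q (\<lambda>x. f x / (k * t)) \<le> (\<integral>\<^sup>+ x. ennreal (1 / t) * ennreal (\<bar>f x / k\<bar> powr q x) \<partial>lebesgue)"
    unfolding vexp_modular_def
  proof (intro nn_integral_mono)
    fix x
    have "\<bar>f x / (k * t)\<bar> powr q x \<le> 1 / t * \<bar>f x / k\<bar> powr q x"
      using pt[of x] t by (simp add: field_simps)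
    then show "ennreal (\<bar>f x / (k * t)\<bar> powr q x) \<le> ennreal (1 / t) * ennreal (\<bar>f x / k\<bar> powr q x)"
      using t by (subst ennreal_mult[symmetric]) (auto intro!: ennreal_leI)
  qed
  also have "\<dots> = ennreal (1 / t) * vexp_modular q (\<lambda>x. f x / k)"
    unfolding vexp_modular_def by (intro nn_integral_cmult) measurable
  also have "\<dots> = ennreal (M / t)"
    using M t by (simp flip: ennreal_mult)
  also have "\<dots> \<le> 1"
    using t by (simp add: ennreal_le_1)
  finally show ?thesis
    using k t by (intro that[of "k * t"]) auto
qed

text \<open>Every admissible level \<open>l\<close> is bounded below: restricting the modular to
  \<open>S\<close> gives \<open>(t / l) powr s * m \<le> 1\<close>, and taking the
  \<open>s\<close>-th root gives the claim for \<open>l\<close>.\<close>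

lemma vexp_norm_ge:
  assumes q: "\<And>x. 1 \<le> q x" "q \<in> borel_measurable lebesgue"
    and g: "g \<in> vexp_space q"
    and S: "S \<in> lmeasurable" "0 < measure lebesgue S" "measure lebesgue S \<le> 1"
    and s: "0 < s" "\<And>x. x \<in> S \<Longrightarrow> s \<le> q x"
    and t: "0 < t" "\<And>x. x \<in> S \<Longrightarrow> t \<le> g x"
  shows "t * measure lebesgue S powr (1 / s) \<le> vexp_norm q g"
  unfolding vexp_norm_def
proof (intro cInf_greatest)
  show "{l. 0 < l \<and> vexp_modular q (\<lambda>x. g x / l) \<le> 1} \<noteq> {}"
    using vexp_space_modular_le_1[OF q g] by auto
next
  fix l assume "l \<in> {l. 0 < l \<and> vexp_modular q (\<lambda>x. g x / l) \<le> 1}"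
  then have l: "0 < l" and mod: "vexp_modular q (\<lambda>x. g x / l) \<le> 1" by auto
  define m where "m = measure lebesgue S"
  have m: "0 < m" "m \<le> 1" using S by (auto simp: m_def)
  have m1: "m powr (1 / s) \<le> 1" using m s by (auto simp: powr_le1)
  show "t * measure lebesgue S powr (1 / s) \<le> l"
  \<comment> \<open>Replacing the exponent \<open>q x\<close> by the smaller \<open>s\<close>
    requires a base \<open>t / l\<close> of at least 1. In the other case
    \<open>m powr (1 / s) \<le> 1\<close> already suffices.\<close>
  proof (cases "t \<le> l")
    case True
    have "t * m powr (1 / s) \<le> t * 1" using m1 t by (intro mult_left_mono) auto
    then show ?thesis using True by (simp add: m_def)
  next
    case False
    then have tl: "1 \<le> t / l" using l by simp
    have "ennreal ((t / l) powr s) * indicator S x \<le> ennreal (\<bar>g x / l\<bar> powr q x)" for x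
    proof (cases "x \<in> S")
      case True
      have "(t / l) powr s \<le> (t / l) powr q x"
        using tl s(2)[OF True] by (intro powr_mono) auto
      also have "\<dots> \<le> \<bar>g x / l\<bar> powr q x"
        using tl t(1) t(2)[OF True] l q(1)[of x]
        by (intro powr_mono2) (auto simp: divide_right_mono)
      finally show ?thesis using True by (auto intro!: ennreal_leI)
    qed auto
    then have "(\<integral>\<^sup>+ x. ennreal ((t / l) powr s) * indicator S x \<partial>lebesgue) \<le> vexp_modular q (\<lambda>x. g x / l)"
      unfolding vexp_modular_def by (intro nn_integral_mono) auto
    moreover have "(\<integral>\<^sup>+ x. ennreal ((t / l) powr s) * indicator S x \<partial>lebesgue) = ennreal ((t / l) powr s) * emeasure lebesgue S"
      using S by (intro nn_integral_cmult_indicator) (auto simp: fmeasurableD)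
    moreover have "\<dots> = ennreal ((t / l) powr s * m)"
      using S by (simp add: m_def emeasure_eq_measure2 ennreal_mult)
    ultimately have "ennreal ((t / l) powr s * m) \<le> 1"
      using mod by (metis order_trans)
    then have "(t / l) powr s * m \<le> 1"
      by (simp add: ennreal_le_1)
    then have "((t / l) powr s * m) powr (1 / s) \<le> 1"
      using s m by (intro powr_le1) auto
    then have "t / l * m powr (1 / s) \<le> 1"
      using s m l t tl by (simp add: powr_mult powr_powr)
    then show ?thesis using l by (simp add: m_def field_simps)
  qed
qed

section \<open>Lower bound for the operator on a ball\<close>

text \<open>The image of the ball lies within \<open>K * r\<close> of \<open>A *v y\<close>. Hence
  \<open>x\<close> has distance between \<open>r\<close> and \<open>(K + L) * r\<close> from each
  image point: the first bound keeps the kernel bounded, the second bounds it from below.\<close>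

lemma T_op_indicator_ball_ge:
  fixes A :: "real^'n^'n"
  assumes \<alpha>: "\<alpha> < real CARD('n)" and r: "0 < r" and K: "0 < K" "\<And>v. norm (A *v v) \<le> K * norm v"
    and x: "(K + 1) * r \<le> norm (x - A *v y)" "norm (x - A *v y) \<le> L * r"
  shows "measure lebesgue (ball y r) / ((K + L) * r) powr (real CARD('n) - \<alpha>)
    \<le> T_op \<alpha> A (indicator (ball y r)) x"
proof -
  define \<beta> where "\<beta> = real CARD('n) - \<alpha>"
  have \<beta>: "0 < \<beta>" using \<alpha> by (simp add: \<beta>_def)
  define k where "k z = 1 / norm (x - A *v z) powr \<beta>" for z
  have near: "norm (x - A *v z) \<ge> r" "norm (x - A *v z) \<le> (K + L) * r" if "z \<in> ball y r" for z
  proof -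
    have "norm (A *v (y - z)) \<le> K * norm (y - z)" by (rule K)
    also have "\<dots> \<le> K * r" using that K by (intro mult_left_mono) (auto simp: dist_norm)
    finally have *: "norm (A *v y - A *v z) \<le> K * r" by (simp add: matrix_vector_mult_diff_distrib)
    have "norm (x - A *v y) \<le> norm (x - A *v z) + norm (A *v y - A *v z)"
      using norm_triangle_ineq4[of "x - A *v z" "A *v y - A *v z"] by simp
    then show "norm (x - A *v z) \<ge> r" using * x by (simp add: algebra_simps)
    have "norm (x - A *v z) \<le> norm (x - A *v y) + norm (A *v y - A *v z)"
      using norm_triangle_ineq[of "x - A *v y" "A *v y - A *v z"] by simp
    then show "norm (x - A *v z) \<le> (K + L) * r" using * x by (simp add: algebra_simps)
  qed
  have ball: "ball y r \<in> lmeasurable" by simp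
  have [measurable]: "k \<in> borel_measurable lebesgue"
  proof -
    have [measurable]: "(*v) A \<in> borel_measurable borel"
      by (intro borel_measurable_continuous_onI matrix_vector_mult_linear_continuous_on)
    have "k \<in> borel_measurable borel"
      unfolding k_def by measurable
    then show ?thesis by (simp add: measurable_completion)
  qed
  have [measurable]: "ball y r \<in> sets lebesgue" by simp
  \<comment> \<open>Without integrability the Bochner integral would take its default value 0 and no
    lower bound could follow. On the ball the kernel is dominated by
    \<open>1 / r powr \<beta>\<close>.\<close>
  have int: "integrable lebesgue (\<lambda>z. k z * indicator (ball y r) z)"
  proof (rule Bochner_Integration.integrable_bound)
    show "integrable lebesgue (\<lambda>z. 1 / r powr \<beta> * indicator (ball y r) z)"
      using ball by (intro integrable_mult_right integrable_real_indicator) (auto simp: fmeasurable_def)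
    show "AE z in lebesgue. norm (k z * indicator (ball y r) z) \<le> norm (1 / r powr \<beta> * indicator (ball y r) z)"
    proof (rule AE_I2)
      fix z
      show "norm (k z * indicator (ball y r) z) \<le> norm (1 / r powr \<beta> * indicator (ball y r) z)"
      proof (cases "z \<in> ball y r")
        case True
        have "r powr \<beta> \<le> norm (x - A *v z) powr \<beta>"
          using near(1)[OF True] r \<beta> by (intro powr_mono2) auto
        then show ?thesis using True r by (auto simp: k_def intro!: frac_le)
      qed auto
    qed
  qed auto
  have "measure lebesgue (ball y r) / ((K + L) * r) powr \<beta>
      = (\<integral> z. 1 / ((K + L) * r) powr \<beta> * indicator (ball y r) z \<partial>lebesgue)"
    by simp
  also have "\<dots> \<le> (\<integral> z. k z * indicator (ball y r) z \<partial>lebesgue)"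
  proof (rule integral_mono[OF _ int])
    show "integrable lebesgue (\<lambda>z. 1 / ((K + L) * r) powr \<beta> * indicator (ball y r) z)"
      using ball by (intro integrable_mult_right integrable_real_indicator) (auto simp: fmeasurable_def)
    fix z
    show "1 / ((K + L) * r) powr \<beta> * indicator (ball y r) z \<le> k z * indicator (ball y r) z"
    proof (cases "z \<in> ball y r")
      case True
      have "norm (x - A *v z) powr \<beta> \<le> ((K + L) * r) powr \<beta>"
        using near[OF True] r \<beta> by (intro powr_mono2) auto
      moreover have "0 < norm (x - A *v z) powr \<beta>"
        using near(1)[OF True] r by auto
      ultimately show ?thesis using True by (auto simp: k_def intro!: frac_le)
    qed auto
  qed
  finally show ?thesis by (simp add: T_op_def k_def \<beta>_def)
qed

text \<open>If \<open>c\<close> lies strictly between the essential supremum and \<open>p x\<close>,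
  the set where \<open>p\<close> exceeds \<open>c\<close> is null, and open by continuity. An open
  null set is empty, yet this one contains \<open>x\<close>.\<close>

lemma continuous_le_esssup:
  fixes p :: "'a::euclidean_space \<Rightarrow> real"
  assumes p: "continuous_on UNIV p"
  shows "ereal (p x) \<le> ess_sup_exponent p"
proof (rule ccontr)
  assume "\<not> ereal (p x) \<le> ess_sup_exponent p"
  then obtain c where c: "ess_sup_exponent p < ereal c" "ereal c < ereal (p x)"
    by (metis ereal_dense2 not_le_imp_less)
  have "p \<in> borel_measurable borel"
    using p by (rule borel_measurable_continuous_onI)
  then have [measurable]: "p \<in> borel_measurable lebesgue"
    by (simp add: measurable_completion)
  have "AE z in lebesgue. ereal (p z) \<le> ess_sup_exponent p"
    unfolding ess_sup_exponent_def by (rule esssup_AE)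
  then have ae: "AE z in lebesgue. p z \<le> c"
    by (rule AE_mp) (use c in \<open>auto intro!: AE_I2 dest: order_le_less_trans\<close>)
  have op: "open {z. c < p z}"
    using p by (intro open_Collect_less continuous_on_const)
  have "{z. c < p z} \<in> null_sets lebesgue"
    using ae by (subst AE_iff_null_sets) (auto simp: op borel_open not_less intro!: sets_completionI_sets)
  then have "{z. c < p z} = {}"
    using op by (metis negligible_iff_null_sets open_not_negligible)
  then show False using c by auto
qed

lemma ex_small_powr_less:
  fixes C D e \<delta> :: real
  assumes "0 < D" "0 < e" "0 < \<delta>"
  obtains u where "0 < u" "u < \<delta>" "C * u powr e < D"
proof -
  have "((\<lambda>u. C * u powr e) \<longlongrightarrow> C * 0) (at_right 0)"
    using assms(2)
    by (intro tendsto_intros tendsto_zero_powrI[where b = e]) (auto intro!: tendsto_intros eventually_at_rightI[of 0 1])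
  then have "eventually (\<lambda>u. C * u powr e < D) (at_right 0)"
    using assms(1) by (auto intro: order_tendstoD(2))
  moreover have "eventually (\<lambda>u::real. u \<in> {0<..<\<delta>}) (at_right 0)"
    using assms(3) by (rule eventually_at_right_real)
  ultimately have "eventually (\<lambda>u. C * u powr e < D \<and> u \<in> {0<..<\<delta>}) (at_right 0)"
    by (rule eventually_conj)
  then obtain u where "C * u powr e < D \<and> u \<in> {0<..<\<delta>}"
    using eventually_happens[of _ "at_right (0::real)"] by (auto simp: trivial_limit_at_right_real)
  then show ?thesis using that by auto
qed

section \<open>Comparison of the exponents at y and A y\<close>

lemma exponent_le_of_T_op_bounded:
  fixes \<alpha> :: real and A :: "real^'n^'n"
    and p q :: "real^'n \<Rightarrow> real"
  assumes \<alpha>: "0 < \<alpha>" "\<alpha> < real CARD('n)"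
    and p1: "\<And>x. 1 \<le> p x" and cont: "continuous_on UNIV p"
    and pbd: "\<And>x. p x < real CARD('n) / \<alpha>"
    and q: "\<And>x. 1 / q x = 1 / p x - \<alpha> / real CARD('n)"
    and bd: "vexp_bounded p q (T_op \<alpha> A)"
  shows "p (A *v y) \<le> p y"
proof (rule ccontr)
  assume "\<not> p (A *v y) \<le> p y"
  then obtain b where b: "p y < b" "b < p (A *v y)" by (meson dense not_le)
  obtain a where a: "b < a" "a < p (A *v y)" using b by (meson dense)
  define n where "n = real CARD('n)"
  have n: "0 < n" by (simp add: n_def)
  have "1 < b" using p1[of y] b by simp
  then have ab1: "1 < a" "1 < b" using a by auto
  have inv: "\<alpha> / n < 1 / p x" for x
    using pbd[of x] p1[of x] \<alpha> n by (simp add: n_def field_simps)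
  have q1: "1 \<le> q x" for x
  proof -
    have "1 / p x \<le> 1" "0 < \<alpha> / n" using p1[of x] \<alpha> n by auto
    then have "0 < 1 / q x" "1 / q x \<le> 1"
      using inv[of x] q[of x] unfolding n_def by linarith+
    then show ?thesis by (auto simp: divide_le_eq_1)
  qed
  have q_meas: "q \<in> borel_measurable lebesgue"
  proof -
    \<comment> \<open>Solving the relation for \<open>q\<close> reduces its measurability to that of
      the continuous \<open>p\<close>.\<close>
    have "q = (\<lambda>x. 1 / (1 / p x - \<alpha> / n))"
      using q by (simp add: n_def flip: q)
    moreover have "p \<in> borel_measurable borel"
      using cont by (rule borel_measurable_continuous_onI)
    then have "p \<in> borel_measurable lebesgue"
      by (simp add: measurable_completion)
    ultimately show ?thesis by simp
  qed
  have "a < n / \<alpha>" using pbd[of "A *v y"] a by (simp add: n_def)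
  then have sa: "0 < 1 / a - \<alpha> / n"
    using ab1 \<alpha> n by (simp add: field_simps)
  \<comment> \<open>\<open>s\<close> is the target exponent paired with \<open>a\<close>, as
    \<open>q x\<close> is with \<open>p x\<close>. The pairing is increasing, so \<open>q\<close> is
    at least \<open>s\<close> wherever \<open>p\<close> is at least \<open>a\<close>.\<close>
  define s where "s = 1 / (1 / a - \<alpha> / n)"
  have s: "0 < s" "1 / s = 1 / a - \<alpha> / n" using sa by (auto simp: s_def)
  have sq: "s \<le> q x" if "a \<le> p x" for x
  proof -
    have "1 / p x \<le> 1 / a" using that ab1 by (intro frac_le) auto
    then have "1 / q x \<le> 1 / s" using q[of x] s by (simp add: n_def)
    then have "inverse (q x) \<le> inverse s" by (simp only: inverse_eq_divide)
    moreover have "0 < q x" using q1[of x] by simp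
    ultimately show ?thesis by (rule inverse_le_imp_le)
  qed
  have op: "open {x. a < p x}" "open {x. p x < b}"
    using cont by (auto intro!: open_Collect_less continuous_on_const)
  obtain d1 where d1: "d1 > 0" "\<And>x. x \<in> ball (A *v y) d1 \<Longrightarrow> a < p x"
    using op(1) a by (auto simp: open_contains_ball subset_eq)
  obtain d2 where d2: "d2 > 0" "\<And>x. x \<in> ball y d2 \<Longrightarrow> p x < b"
    using op(2) b by (auto simp: open_contains_ball subset_eq)
  obtain K where K: "0 < K" "\<And>v. norm (A *v v) \<le> K * norm v"
  proof -
    have "bounded_linear (\<lambda>v. A *v v)" by (rule matrix_vector_mul_bounded_linear)
    then show ?thesis using that bounded_linear.pos_bounded[of "\<lambda>v. A *v v"]
      by (metis mult.commute)
  qed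
  obtain e :: "real^'n" where e: "norm e = 1"
    using vector_choose_size[of 1] by auto
  obtain C where C: "\<And>f. f \<in> vexp_space p \<Longrightarrow> T_op \<alpha> A f \<in> vexp_space q
      \<and> vexp_norm q (T_op \<alpha> A f) \<le> C * vexp_norm p f"
    using bd by (auto simp: vexp_bounded_def)
  define V where "V = unit_ball_vol n"
  have V: "0 < V" by (simp add: V_def n_def unit_ball_vol_pos)
  \<comment> \<open>With \<open>L = K + 3\<close> the lower bound for the operator is
    \<open>V * r powr n / ((2 * K + 3) * r) powr (n - \<alpha>)\<close>, which equals
    \<open>D * r powr \<alpha>\<close>.\<close>
  define D where "D = V / (2 * K + 3) powr (n - \<alpha>)"
  have D: "0 < D" using V K by (simp add: D_def)
  \<comment> \<open>The first two bounds give \<open>V * r powr n \<le> V * r \<le> 1\<close>, the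
    third keeps \<open>B\<close> inside the region \<open>p < b\<close>, and the last keeps
    \<open>B'\<close> inside the region \<open>a < p\<close>.\<close>
  define r0 where "r0 = Min {1, 1 / V, d2, d1 / (K + 3)}"
  have r0: "0 < r0" "r0 \<le> 1" "r0 \<le> 1 / V" "r0 \<le> d2" "r0 \<le> d1 / (K + 3)"
    using V d1 d2 K by (auto simp: r0_def)
  have vol: "measure lebesgue (ball c r) = V * r powr n" if "r > 0" for c :: "real^'n" and r
    using that by (simp add: content_ball V_def n_def powr_realpow)
  \<comment> \<open>This is the norm inequality for \<open>indicator B\<close> divided by
    \<open>r powr (n / a)\<close>. The left side no longer depends on \<open>r\<close>, while the
    power on the right is positive because \<open>b < a\<close>.\<close>
  have key: "D * V powr (1 / s) \<le> (\<bar>C\<bar> * V powr (1 / b)) * r powr (n * (1 / b - 1 / a))"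
    if r: "0 < r" "r < r0" for r
  proof -
    define m where "m = V * r powr n"
    have "r powr n \<le> r powr 1"
      using r r0 by (intro powr_mono') (auto simp: n_def)
    also have "\<dots> \<le> 1 / V" using r r0 by simp
    finally have m1: "m \<le> 1" using V by (simp add: m_def field_simps)
    have m: "0 < m" using V r by (simp add: m_def)
    define B where "B = ball y r"
    \<comment> \<open>The centre is at distance \<open>(K + 2) * r\<close> from
      \<open>A *v y\<close>, so points of \<open>B'\<close> have distance between
      \<open>(K + 1) * r\<close> and \<open>(K + 3) * r\<close> from it. Since the image of
      \<open>B\<close> lies within \<open>K * r\<close>, a gap of at least \<open>r\<close>
      remains.\<close>
    define B' where "B' = ball (A *v y + ((K + 2) * r) *\<^sub>R e) r"
    have pB: "p x \<le> b" if "x \<in> B" for x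
      using d2(2)[of x] that r r0 by (force simp: B_def)
    have BB: "measure lebesgue B = m" "measure lebesgue B' = m"
      using vol[OF r(1)] by (auto simp: B_def B'_def m_def)
    have lm: "B \<in> lmeasurable" "B' \<in> lmeasurable" by (auto simp: B_def B'_def)
    have nB': "(K + 1) * r \<le> norm (x - A *v y)" "norm (x - A *v y) \<le> (K + 3) * r" if "x \<in> B'" for x
    proof -
      define w where "w = ((K + 2) * r) *\<^sub>R e"
      have w: "norm w = (K + 2) * r" using e K r by (simp add: w_def)
      have "x \<in> ball (A *v y + w) r"
        using that by (simp add: B'_def w_def)
      then have "norm (x - A *v y - w) < r"
        by (simp add: dist_norm diff_diff_eq norm_minus_commute[of x])
      then show "(K + 1) * r \<le> norm (x - A *v y)" "norm (x - A *v y) \<le> (K + 3) * r"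
        using norm_triangle_ineq[of "x - A *v y - w" w] norm_triangle_ineq4[of "x - A *v y" "x - A *v y - w"] w
        by (auto simp: algebra_simps)
    qed
    have pB': "a \<le> p x" if "x \<in> B'" for x
    proof -
      have "norm (x - A *v y) \<le> (K + 3) * r" by (rule nB'[OF that])
      also have "\<dots> < (K + 3) * (d1 / (K + 3))" using K r r0 by (intro mult_strict_left_mono) auto
      also have "\<dots> = d1" using K by simp
      finally show ?thesis using d1(2)[of x] by (auto simp: dist_norm norm_minus_commute)
    qed
    have b0: "0 < b" using ab1 by simp
    have ind: "indicator B \<in> vexp_space p" "vexp_norm p (indicator B) \<le> m powr (1 / b)"
        "0 \<le> vexp_norm p (indicator B)"
      using indicator_in_vexp_space[where p = p, OF lm(1) _ _ b0 pB] m m1 by (auto simp: BB)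
    define t where "t = D * r powr \<alpha>"
    have t: "t \<le> T_op \<alpha> A (indicator B) x" if "x \<in> B'" for x
    proof -
      have "m / ((K + (K + 3)) * r) powr (n - \<alpha>) \<le> T_op \<alpha> A (indicator B) x"
        using T_op_indicator_ball_ge[OF \<alpha>(2) r(1) K nB'[OF that]] BB(1) by (simp add: B_def n_def)
      also have "m / ((K + (K + 3)) * r) powr (n - \<alpha>) = t"
      proof -
        have "r powr n = r powr \<alpha> * r powr (n - \<alpha>)" by (simp flip: powr_add)
        then show ?thesis using r K
          by (simp add: m_def t_def D_def powr_mult)
      qed
      finally show ?thesis .
    qed
    have t0: "0 < t" using D r by (simp add: t_def)
    have "T_op \<alpha> A (indicator B) \<in> vexp_space q"
      using C[OF ind(1)] by simp
    then have "t * measure lebesgue B' powr (1 / s) \<le> vexp_norm q (T_op \<alpha> A (indicator B))"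
      using lm(2) BB(2) m m1 s(1) sq pB' t0 t by (intro vexp_norm_ge q1 q_meas) auto
    then have "t * m powr (1 / s) \<le> vexp_norm q (T_op \<alpha> A (indicator B))"
      by (simp only: BB)
    also have "\<dots> \<le> C * vexp_norm p (indicator B)"
      using C[OF ind(1)] by simp
    also have "\<dots> \<le> \<bar>C\<bar> * vexp_norm p (indicator B)"
      using ind(3) by (intro mult_right_mono) auto
    also have "\<dots> \<le> \<bar>C\<bar> * m powr (1 / b)"
      using ind(2) by (intro mult_left_mono) auto
    finally have ineq: "D * r powr \<alpha> * (V powr (1 / s) * r powr (n / s)) \<le> \<bar>C\<bar> * (V powr (1 / b) * r powr (n / b))"
      using V r by (simp add: t_def m_def powr_mult powr_powr)
    \<comment> \<open>The factor \<open>r powr \<alpha>\<close> gained from the kernel exactly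
      offsets the shift by \<open>\<alpha> / n\<close> in \<open>1 / s\<close>.\<close>
    have lhs: "r powr \<alpha> * r powr (n / s) = r powr (n / a)"
    proof -
      have "\<alpha> + n / s = \<alpha> + n * (1 / s)" by simp
      also have "\<dots> = n / a" unfolding s(2) using n by (simp add: right_diff_distrib)
      finally show ?thesis by (simp flip: powr_add)
    qed
    have rhs: "r powr (n / b) = r powr (n * (1 / b - 1 / a)) * r powr (n / a)"
      by (simp flip: powr_add add: right_diff_distrib)
    have "(D * V powr (1 / s)) * r powr (n / a) = D * r powr \<alpha> * (V powr (1 / s) * r powr (n / s))"
      unfolding lhs[symmetric] by (simp only: mult_ac)
    also have "\<dots> \<le> \<bar>C\<bar> * (V powr (1 / b) * r powr (n / b))"
      by (rule ineq)
    also have "\<dots> = (\<bar>C\<bar> * V powr (1 / b) * r powr (n * (1 / b - 1 / a))) * r powr (n / a)"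
      unfolding rhs by (simp only: mult_ac)
    finally have "(D * V powr (1 / s)) * r powr (n / a)
        \<le> (\<bar>C\<bar> * V powr (1 / b) * r powr (n * (1 / b - 1 / a))) * r powr (n / a)" .
    then show ?thesis using r by (simp add: mult_le_cancel_right)
  qed
  have "0 < D * V powr (1 / s)" using D V by simp
  moreover have "0 < n * (1 / b - 1 / a)"
    using n a ab1 by (simp add: field_simps)
  ultimately obtain r where r: "0 < r" "r < r0"
    "(\<bar>C\<bar> * V powr (1 / b)) * r powr (n * (1 / b - 1 / a)) < D * V powr (1 / s)"
    using r0(1) by (rule ex_small_powr_less)
  show False using key[OF r(1,2)] r(3) by linarith
qed

section \<open>Equality along orbits of a matrix of finite order\<close>

theorem corollary5:
  fixes \<alpha> :: real and A :: "real^'n^'n" and N :: nat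
    and p q :: "real^'n \<Rightarrow> real"
  assumes "0 < \<alpha>" and "\<alpha> < real CARD('n)"
    and "N \<ge> 1" and "matrix_power A N = mat 1"
    and "\<And>x. 1 \<le> p x" and "continuous_on UNIV p"
    and "ess_sup_exponent p < ereal (real CARD('n) / \<alpha>)"
    and "\<And>x. 1 / q x = 1 / p x - \<alpha> / real CARD('n)"
    and "vexp_bounded p q (T_op \<alpha> A)"
  shows "\<forall>y. p (A *v y) = p y"
proof
  fix y
  have "p x < real CARD('n) / \<alpha>" for x
    using continuous_le_esssup[OF assms(6), of x] assms(7)
    by (metis le_less_trans less_ereal.simps(1))
  then have le: "p (A *v y) \<le> p y" for y
    using assms by (intro exponent_le_of_T_op_bounded[of \<alpha> p q A])
  \<comment> \<open>Along the orbit of \<open>y\<close> the exponent cannot increase, and the orbit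
    is back at \<open>y\<close> after \<open>N\<close> steps. As \<open>N \<ge> 1\<close>, this
    gives \<open>p y = g N \<le> g 1 = p (A *v y)\<close>.\<close>
  define g where "g k = p (matrix_power A k *v y)" for k
  have step: "g (Suc k) \<le> g k" for k
    using le[of "matrix_power A k *v y"]
    by (simp add: g_def matrix_power_def matrix_vector_mul_assoc)
  have "g N \<le> g 1"
    using step assms(3) by (rule lift_Suc_antimono_le)
  then have "p y \<le> p (A *v y)"
    using assms(4) by (simp add: g_def matrix_power_def)
  then show "p (A *v y) = p y"
    using le[of y] by simp
qed

end
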